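(* Let $s\in(0,1)$, $R\ge2$, and let $u$ be a minimizer of $\mathcal E^p_s$ in $X^{s,p}(B_{R+2})$. Then there exists $\bar C\in(0,+\infty)$ depending only on $n,p,m,\Lambda$ such that $$\mathcal E^p_s(u,B_R)\le\frac{\bar C}{s}\begin{cases}\dfrac{R^{n-sp}}{1-sp}&\text{if } s\in(0,\frac1p),\\[2mm] R^{n-1}\log R&\text{if } s=\frac1p,\\[1mm] \dfrac{R^{n-1}}{sp-1}&\text{if } s\in(\frac1p,1).\end{cases}$$
   Context: Standing setting: $n\in\mathbb N$, $p\in(1,+\infty)$, $B_r$ the open ball of radius $r$ centered at $0$. $W:[-1,1]\to[0,+\infty)$ is lower semicontinuous and satisfies: (W1) there are $\lambda\in(0,1]$, $\Lambda\in[1,+\infty)$, $\theta\in(-1,1)$, $m\in[p,+\infty)$ with $\lambda\chi_{(-\infty,\theta]}(x)|1+x|^m\le W(x)\le\Lambda|1+x|^m$ for all $x\in[-1,1]$; (W2) there are $q\in(0,1)$, $c_1\in(0,+\infty)$ such that for all $-1\le r\le t\le -1+q$, $W(t)-W(r)\ge c_1(t-r)|1+r|^{m-1}+c_1(t-r)^k$, where $k=m$ if $m\in\mathbb N$ and $k=\lfloor m\rfloor+1$ otherwise. For an open set $\Omega$ and measurable $u:\mathbb R^n\to\mathbb R$, $\mathcal K^p_s(u,\Omega):=\frac12\int_\Omega\int_\Omega\frac{|u(x)-u(y)|^p}{|x-y|^{n+sp}}dx\,dy+\int_\Omega\int_{\mathbb R^n\setminus\Omega}\frac{|u(x)-u(y)|^p}{|x-y|^{n+sp}}dx\,dy$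 and $\mathcal E^p_s(u,\Omega):=(1-s)\mathcal K^p_s(u,\Omega)+\int_\Omega W(u(x))dx$. $X^{s,p}(\Omega)$ is the set of measurable $u:\mathbb R^n\to\mathbb R$ with $\mathcal K^p_s(u,\Omega)<\infty$ and $\|u\|_{L^\infty(\mathbb R^n)}\le1$. "$u$ is a minimizer of $\mathcal E^p_s$ in $X^{s,p}(\Omega)$" means $u\in X^{s,p}(\Omega)$ and $\mathcal E^p_s(u,\Omega)\le\mathcal E^p_s(v,\Omega)$ for all $v\in X^{s,p}(\Omega)$ with $v=u$ a.e. in $\mathbb R^n\setminus\Omega$. *)

theory Defs
  imports "HOL-Analysis.Analysis"
begin

definition lsc_on_interval :: "(real \<Rightarrow> real) \<Rightarrow> bool" where
  "lsc_on_interval W \<longleftrightarrow> (\<forall>x\<in>{-1..1}. \<forall>t. t < W x \<longrightarrow>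
      (\<exists>e>0. \<forall>y\<in>{-1..1}. \<bar>y - x\<bar> < e \<longrightarrow> t < W y))"

definition W1 :: "(real \<Rightarrow> real) \<Rightarrow> real \<Rightarrow> real \<Rightarrow> real \<Rightarrow> real \<Rightarrow> bool" where
  "W1 W lam Lam theta m \<longleftrightarrow>
     (\<forall>x\<in>{-1..1}. lam * indicator {..theta} x * \<bar>1 + x\<bar> powr m \<le> W x
                  \<and> W x \<le> Lam * \<bar>1 + x\<bar> powr m)"

definition kexp :: "real \<Rightarrow> real" where
  "kexp m = (if m \<in> \<nat> then m else of_int \<lfloor>m\<rfloor> + 1)"

definition W2 :: "(real \<Rightarrow> real) \<Rightarrow> real \<Rightarrow> real \<Rightarrow> real \<Rightarrow> bool" where
  "W2 W q c1 m \<longleftrightarrow>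
     (\<forall>r t. -1 \<le> r \<and> r \<le> t \<and> t \<le> -1 + q \<longrightarrow>
        W t - W r \<ge> c1 * (t - r) * \<bar>1 + r\<bar> powr (m - 1) + c1 * (t - r) powr (kexp m))"

definition Kps :: "real \<Rightarrow> real \<Rightarrow> ('a::euclidean_space \<Rightarrow> real) \<Rightarrow> 'a set \<Rightarrow> ennreal" where
  "Kps p s u \<Omega> =
     (1/2) * (\<integral>\<^sup>+ x. \<integral>\<^sup>+ y. ennreal (indicator \<Omega> x * indicator \<Omega> y *
          (\<bar>u x - u y\<bar> powr p / norm (x - y) powr (real DIM('a) + s * p))) \<partial>lebesgue \<partial>lebesgue)
   + (\<integral>\<^sup>+ x. \<integral>\<^sup>+ y. ennreal (indicator \<Omega> x * indicator (- \<Omega>) y *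
          (\<bar>u x - u y\<bar> powr p / norm (x - y) powr (real DIM('a) + s * p))) \<partial>lebesgue \<partial>lebesgue)"

definition Eps :: "(real \<Rightarrow> real) \<Rightarrow> real \<Rightarrow> real \<Rightarrow> ('a::euclidean_space \<Rightarrow> real) \<Rightarrow> 'a set \<Rightarrow> ennreal" where
  "Eps W p s u \<Omega> = ennreal (1 - s) * Kps p s u \<Omega>
     + (\<integral>\<^sup>+ x. ennreal (indicator \<Omega> x * W (u x)) \<partial>lebesgue)"

definition Xsp :: "real \<Rightarrow> real \<Rightarrow> 'a::euclidean_space set \<Rightarrow> ('a \<Rightarrow> real) set" where
  "Xsp s p \<Omega> = {u. u \<in> borel_measurable lebesgue \<and> Kps p s u \<Omega> < \<infinity>
                     \<and> (AE x in lebesgue. \<bar>u x\<bar> \<le> 1)}"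

definition minimizer :: "(real \<Rightarrow> real) \<Rightarrow> real \<Rightarrow> real \<Rightarrow> ('a::euclidean_space \<Rightarrow> real) \<Rightarrow> 'a set \<Rightarrow> bool" where
  "minimizer W p s u \<Omega> \<longleftrightarrow> u \<in> Xsp s p \<Omega> \<and>
     (\<forall>v \<in> Xsp s p \<Omega>. (AE x in lebesgue. x \<notin> \<Omega> \<longrightarrow> v x = u x) \<longrightarrow> Eps W p s u \<Omega> \<le> Eps W p s v \<Omega>)"

end

theory Submission
  imports Defs
begin

text \<open>
  Let $\psi = -1$ in $B_{R+1}$, $\psi = 1$ outside $B_{R+2}$, with $\psi$ affine in $|x|$ in between.
  Since $t \mapsto |t|^p$ is convex, the energy is submodular:
  $\mathcal{E}(\min(u,\psi)) + \mathcal{E}(\max(u,\psi)) \le \mathcal{E}(u) + \mathcal{E}(\psi)$ in $B_{R+2}$.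
  Now $\min(u,\psi)$ is an admissible competitor for $u$, so $\mathcal{E}(\max(u,\psi)) \le \mathcal{E}(\psi)$;
  and $\max(u,\psi) = u$ in $B_{R+1}$, so this controls all of $\mathcal{E}(u, B_R)$ except for the
  interaction of $B_R$ with the complement of $B_{R+1}$, for which $|u| \le 1$ suffices.
  Both that interaction and $\mathcal{E}(\psi)$ reduce to the volume of the shell
  $B_{R+2} \setminus B_R$ and to $\int_0^R (R+1-r)^{-sp}\,dr$, whose size depends on the sign of $sp - 1$.
\<close>

subsection \<open>Radial integrals\<close>

definition sphere_area :: "'a::euclidean_space itself \<Rightarrow> real" where
  "sphere_area _ = real DIM('a) * unit_ball_vol (real DIM('a))"

lemma sphere_area_pos [simp]: "sphere_area TYPE('a::euclidean_space) > 0"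
  by (simp add: sphere_area_def)

lemma sphere_area_nonneg [simp]: "sphere_area TYPE('a::euclidean_space) \<ge> 0"
  by (simp add: less_imp_le)

lemma emeasure_distr_norm_atMost:
  "emeasure (distr lborel borel (norm :: 'a::euclidean_space \<Rightarrow> real)) {..b} =
     ennreal (unit_ball_vol DIM('a) * b ^ DIM('a)) * indicator {0..} b"
proof -
  have "emeasure (distr lborel borel (norm :: 'a \<Rightarrow> real)) {..b} = emeasure lborel (cball (0::'a) b)"
    by (subst emeasure_distr) (auto intro!: arg_cong[where f="emeasure lborel"] simp: vimage_def)
  then show ?thesis
    by (cases "b \<ge> 0") (auto simp: emeasure_cball)
qed

lemma emeasure_density_power_atMost:
  "emeasure (density lborel
      (\<lambda>r. ennreal (sphere_area TYPE('a::euclidean_space) * r ^ (DIM('a) - 1)) * indicator {0..} r)) {..b} =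
     ennreal (unit_ball_vol DIM('a) * b ^ DIM('a)) * indicator {0..} b"
proof -
  let ?f = "\<lambda>r. sphere_area TYPE('a) * r ^ (DIM('a) - 1)"
  have "emeasure (density lborel (\<lambda>r. ennreal (?f r) * indicator {0..} r)) {..b} =
      (\<integral>\<^sup>+r. ennreal (?f r) * indicator {0..b} r \<partial>lborel)"
    by (subst emeasure_density) (auto intro!: nn_integral_cong split: split_indicator)
  also have "\<dots> = ennreal (unit_ball_vol DIM('a) * b ^ DIM('a)) * indicator {0..} b"
  proof (cases "b \<ge> 0")
    case True
    have "(\<integral>\<^sup>+r. ennreal (?f r) * indicator {0..b} r \<partial>lborel)
        = unit_ball_vol DIM('a) * b ^ DIM('a) - unit_ball_vol DIM('a) * 0 ^ DIM('a)"
      using True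
      by (intro nn_integral_FTC_Icc)
         (auto simp: sphere_area_def intro!: derivative_eq_intros mult_nonneg_nonneg)
    with True show ?thesis by simp
  qed auto
  finally show ?thesis .
qed

lemma distr_norm_lborel:
  "distr lborel borel (norm :: 'a::euclidean_space \<Rightarrow> real) =
     density lborel (\<lambda>r. ennreal (sphere_area TYPE('a) * r ^ (DIM('a) - 1)) * indicator {0..} r)"
    (is "?M = ?N")
proof (rule measure_eqI_generator_eq[where E = "range (\<lambda>b::real. {..b})" and \<Omega> = UNIV
      and A = "\<lambda>i::nat. {..real i}"])
  show "Int_stable (range (\<lambda>b::real. {..b}))"
    by (auto simp: Int_stable_def)
  show "emeasure ?M X = emeasure ?N X" if "X \<in> range (\<lambda>b::real. {..b})" for X
    using that emeasure_distr_norm_atMost emeasure_density_power_atMost[where 'a='a] by auto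
  show "(\<Union>i. {..real i}) = UNIV"
    by (auto intro: real_arch_simple)
  show "emeasure ?M {..real i} \<noteq> \<infinity>" for i
    by (auto simp: emeasure_distr_norm_atMost indicator_def)
qed (auto simp: borel_eq_atMost)

lemma nn_integral_norm:
  fixes f :: "real \<Rightarrow> ennreal"
  assumes [measurable]: "f \<in> borel_measurable borel"
  shows "(\<integral>\<^sup>+(x::'a::euclidean_space). f (norm x) \<partial>lborel) =
    (\<integral>\<^sup>+r. ennreal (sphere_area TYPE('a) * r ^ (DIM('a) - 1)) * indicator {0..} r * f r \<partial>lborel)"
proof -
  have "(\<integral>\<^sup>+(x::'a). f (norm x) \<partial>lborel) = (\<integral>\<^sup>+r. f r \<partial>distr lborel borel (norm :: 'a \<Rightarrow> real))"
    by (subst nn_integral_distr) auto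
  then show ?thesis
    unfolding distr_norm_lborel by (subst (asm) nn_integral_density) auto
qed

lemma nn_integral_ball_norm_le:
  fixes f :: "real \<Rightarrow> ennreal"
  assumes [measurable]: "f \<in> borel_measurable borel" and "b \<ge> 0"
  shows "(\<integral>\<^sup>+(x::'a::euclidean_space). indicator (ball 0 b) x * f (norm x) \<partial>lborel)
    \<le> ennreal (sphere_area TYPE('a) * b ^ (DIM('a) - 1)) * (\<integral>\<^sup>+r. f r * indicator {0..b} r \<partial>lborel)"
proof -
  have "(\<integral>\<^sup>+(x::'a). indicator (ball 0 b) x * f (norm x) \<partial>lborel)
      = (\<integral>\<^sup>+(x::'a). indicator {..<b} (norm x) * f (norm x) \<partial>lborel)"
    by (intro nn_integral_cong) (auto split: split_indicator)
  also have "\<dots> = (\<integral>\<^sup>+r. ennreal (sphere_area TYPE('a) * r ^ (DIM('a) - 1)) * indicator {0..} r *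
      (indicator {..<b} r * f r) \<partial>lborel)"
    by (rule nn_integral_norm) measurable
  also have "\<dots> \<le> (\<integral>\<^sup>+r. ennreal (sphere_area TYPE('a) * b ^ (DIM('a) - 1)) * (f r * indicator {0..b} r) \<partial>lborel)"
    by (intro nn_integral_mono)
       (auto intro!: mult_right_mono ennreal_leI mult_left_mono power_mono split: split_indicator)
  also have "\<dots> = ennreal (sphere_area TYPE('a) * b ^ (DIM('a) - 1)) * (\<integral>\<^sup>+r. f r * indicator {0..b} r \<partial>lborel)"
    by (rule nn_integral_cmult) measurable
  finally show ?thesis .
qed

lemma emeasure_shell_le:
  assumes "0 \<le> a" "a \<le> b"
  shows "emeasure lborel (ball (0::'a::euclidean_space) b - ball 0 a)
    \<le> ennreal (sphere_area TYPE('a) * b ^ (DIM('a) - 1) * (b - a))"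
proof -
  have "emeasure lborel (ball (0::'a) b - ball 0 a)
      = (\<integral>\<^sup>+(x::'a). indicator (ball 0 b) x * indicator {a..} (norm x) \<partial>lborel)"
    by (subst nn_integral_indicator[symmetric], simp, rule nn_integral_cong) (auto split: split_indicator)
  also have "\<dots> \<le> ennreal (sphere_area TYPE('a) * b ^ (DIM('a) - 1)) *
      (\<integral>\<^sup>+r. indicator {a..} r * indicator {0..b} r \<partial>lborel)"
    using assms by (intro nn_integral_ball_norm_le) auto
  also have "(\<integral>\<^sup>+r. indicator {a..} r * indicator {0..b} r \<partial>lborel) = (\<integral>\<^sup>+r. indicator {a..b} r \<partial>lborel)"
    using assms by (intro nn_integral_cong) (auto split: split_indicator)
  also have "\<dots> = ennreal (b - a)"
    using assms by simp
  finally show ?thesis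
    using assms by (simp flip: ennreal_mult)
qed

lemma power_mult_powr:
  fixes r e :: real
  assumes "r \<ge> 0" "n \<ge> 1"
  shows "r ^ (n - 1) * r powr (e - real n) = r powr (e - 1)"
  using assms by (cases "r = 0") (simp_all flip: powr_realpow powr_add)

lemma nn_integral_norm_powr:
  fixes e :: real
  assumes [measurable]: "A \<in> sets borel" and "A \<subseteq> {0..}"
  shows "(\<integral>\<^sup>+(z::'a::euclidean_space). ennreal (indicator A (norm z) * norm z powr (e - DIM('a))) \<partial>lborel)
     = ennreal (sphere_area TYPE('a)) * (\<integral>\<^sup>+r. ennreal (r powr (e - 1)) * indicator A r \<partial>lborel)"
proof -
  let ?c = "sphere_area TYPE('a)"
  have radial_density: "ennreal (?c * r ^ (DIM('a) - 1)) * indicator {0..} r *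
        ennreal (indicator A r * r powr (e - DIM('a)))
      = ennreal ?c * (ennreal (r powr (e - 1)) * indicator A r)" for r
  proof (cases "r \<in> A")
    case True
    with assms have "?c * r ^ (DIM('a) - 1) * r powr (e - DIM('a)) = ?c * r powr (e - 1)"
      using power_mult_powr[of r "DIM('a)" e] by (auto simp: Suc_le_eq mult.assoc)
    with True assms show ?thesis by (auto simp flip: ennreal_mult)
  qed simp
  have "(\<integral>\<^sup>+(z::'a). ennreal (indicator A (norm z) * norm z powr (e - DIM('a))) \<partial>lborel)
    = (\<integral>\<^sup>+r. ennreal (?c * r ^ (DIM('a) - 1)) * indicator {0..} r *
         ennreal (indicator A r * r powr (e - DIM('a))) \<partial>lborel)"
    by (rule nn_integral_norm) measurable
  also have "\<dots> = ennreal ?c * (\<integral>\<^sup>+r. ennreal (r powr (e - 1)) * indicator A r \<partial>lborel)"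
    unfolding radial_density by (rule nn_integral_cmult) measurable
  finally show ?thesis .
qed

lemma nn_integral_norm_powr_inside_cball:
  fixes e d :: real
  assumes "e > 0" "d \<ge> 0"
  shows "(\<integral>\<^sup>+(z::'a::euclidean_space). ennreal (indicator {0..d} (norm z) * norm z powr (e - DIM('a))) \<partial>lborel)
     = ennreal (sphere_area TYPE('a) * d powr e / e)"
proof -
  have "((\<lambda>r. r powr (e - 1)) has_integral d powr e / e) {0..d}"
    using has_integral_powr_from_0[of "e - 1" d] assms by simp
  from nn_integral_has_integral_lebesgue'[OF _ this]
  have "(\<integral>\<^sup>+r. ennreal (r powr (e - 1)) * indicator {0..d} r \<partial>lborel) = ennreal (d powr e / e)"
    by simp
  then show ?thesis
    using assms by (simp add: nn_integral_norm_powr flip: ennreal_mult)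
qed

lemma nn_integral_norm_powr_outside_ball:
  fixes \<sigma> d :: real
  assumes "\<sigma> > 0" "d > 0"
  shows "(\<integral>\<^sup>+(z::'a::euclidean_space). ennreal (indicator {d..} (norm z) * norm z powr (- (DIM('a) + \<sigma>))) \<partial>lborel)
     = ennreal (sphere_area TYPE('a) * d powr (-\<sigma>) / \<sigma>)"
proof -
  have "((\<lambda>r. r powr (-\<sigma> - 1)) has_integral d powr (-\<sigma>) / \<sigma>) {d..}"
    using has_integral_powr_to_inf[of "-\<sigma> - 1" d] assms by simp
  from nn_integral_has_integral_lebesgue'[OF _ this]
  have "(\<integral>\<^sup>+r. ennreal (r powr (-\<sigma> - 1)) * indicator {d..} r \<partial>lborel) = ennreal (d powr (-\<sigma>) / \<sigma>)"
    by simp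
  moreover have exponent: "- (real DIM('a) + \<sigma>) = - \<sigma> - DIM('a)"
    by simp
  ultimately show ?thesis
    unfolding exponent using assms by (subst nn_integral_norm_powr) (auto simp flip: ennreal_mult)
qed

lemma nn_integral_lborel_diff:
  fixes f :: "'a::euclidean_space \<Rightarrow> ennreal"
  assumes [measurable]: "f \<in> borel_measurable borel"
  shows "(\<integral>\<^sup>+y. f (x - y) \<partial>lborel) = (\<integral>\<^sup>+z. f z \<partial>lborel)"
proof -
  have "(\<integral>\<^sup>+z. f z \<partial>lborel) = (\<integral>\<^sup>+z. f z \<partial>density (distr lborel borel (\<lambda>y. x + (-1::real) *\<^sub>R y)) (\<lambda>_. 1))"
    by (subst lborel_affine[of "-1" x]) simp_all
  then show ?thesis
    by (simp add: density_1 nn_integral_distr)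
qed

lemma nn_integral_kernel_outside_ball_le:
  fixes x :: "'a::euclidean_space" and \<sigma> r :: real
  assumes "\<sigma> > 0" "norm x < r"
  shows "(\<integral>\<^sup>+y. ennreal (indicator (- ball 0 r) y / norm (x - y) powr (DIM('a) + \<sigma>)) \<partial>lborel)
     \<le> ennreal (sphere_area TYPE('a) * (r - norm x) powr (-\<sigma>) / \<sigma>)"
proof -
  define f :: "'a \<Rightarrow> ennreal" where
    "f z = ennreal (indicator {r - norm x..} (norm z) * norm z powr (- (DIM('a) + \<sigma>)))" for z
  have [measurable]: "f \<in> borel_measurable borel"
    unfolding f_def by measurable
  have "ennreal (indicator (- ball 0 r) y / norm (x - y) powr (DIM('a) + \<sigma>)) \<le> f (x - y)" for y
  proof -
    have "r - norm x \<le> norm (x - y)" if "y \<notin> ball 0 r"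
      using that norm_triangle_ineq2[of y x] by (simp add: norm_minus_commute)
    moreover have "norm (x - y) powr (- (DIM('a) + \<sigma>)) = 1 / norm (x - y) powr (DIM('a) + \<sigma>)"
      by (rule powr_minus_divide)
    ultimately show ?thesis
      unfolding f_def by (intro ennreal_leI) (auto split: split_indicator)
  qed
  then have "(\<integral>\<^sup>+y. ennreal (indicator (- ball 0 r) y / norm (x - y) powr (DIM('a) + \<sigma>)) \<partial>lborel)
     \<le> (\<integral>\<^sup>+y. f (x - y) \<partial>lborel)"
    by (intro nn_integral_mono) auto
  also have "\<dots> = (\<integral>\<^sup>+z. f z \<partial>lborel)"
    by (rule nn_integral_lborel_diff) measurable
  also have "\<dots> = ennreal (sphere_area TYPE('a) * (r - norm x) powr (-\<sigma>) / \<sigma>)"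
    unfolding f_def using assms by (intro nn_integral_norm_powr_outside_ball) auto
  finally show ?thesis .
qed

definition truncated_kernel :: "real \<Rightarrow> real \<Rightarrow> 'a::euclidean_space \<Rightarrow> real" where
  "truncated_kernel p s z = min 1 (norm z) powr p / norm z powr (real DIM('a) + s * p)"

lemma borel_measurable_truncated_kernel [measurable]: "truncated_kernel p s \<in> borel_measurable borel"
  unfolding truncated_kernel_def[abs_def] by measurable

lemma nn_integral_truncated_kernel_le:
  fixes s p :: real
  assumes "0 < s" "s < 1" "p > 0"
  shows "(\<integral>\<^sup>+(z::'a::euclidean_space). ennreal (truncated_kernel p s z) \<partial>lborel)
     \<le> ennreal (sphere_area TYPE('a) / (p * (1 - s)) + sphere_area TYPE('a) / (s * p))"
proof -
  let ?c = "sphere_area TYPE('a)"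
  define near :: "'a \<Rightarrow> ennreal" where
    "near z = ennreal (indicator {0..1} (norm z) * norm z powr (p * (1 - s) - DIM('a)))" for z
  define far :: "'a \<Rightarrow> ennreal" where
    "far z = ennreal (indicator {1..} (norm z) * norm z powr (- (DIM('a) + s * p)))" for z
  have [measurable]: "near \<in> borel_measurable borel" "far \<in> borel_measurable borel"
    unfolding near_def far_def by measurable
  have "ennreal (truncated_kernel p s z) \<le> near z + far z" for z
  proof (cases "norm z \<le> 1")
    case True
    then have "ennreal (truncated_kernel p s z) = near z"
      by (simp add: truncated_kernel_def near_def algebra_simps flip: powr_diff)
    then show ?thesis by simp
  next
    case False
    then have "ennreal (truncated_kernel p s z) = far z"
      by (simp add: truncated_kernel_def far_def flip: powr_minus_divide)
    then show ?thesis by simp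
  qed
  then have "(\<integral>\<^sup>+(z::'a). ennreal (truncated_kernel p s z) \<partial>lborel) \<le> (\<integral>\<^sup>+z. near z + far z \<partial>lborel)"
    by (intro nn_integral_mono) auto
  also have "\<dots> = (\<integral>\<^sup>+z. near z \<partial>lborel) + (\<integral>\<^sup>+z. far z \<partial>lborel)"
    by (rule nn_integral_add) auto
  also have "\<dots> = ennreal (?c / (p * (1 - s))) + ennreal (?c / (s * p))"
    unfolding near_def far_def using assms
    by (subst nn_integral_norm_powr_inside_cball, simp, simp, subst nn_integral_norm_powr_outside_ball) auto
  finally show ?thesis
    using assms by simp
qed

lemma weighted_nn_integral_truncated_kernel_le:
  fixes s p :: real
  assumes "0 < s" "s < 1" "p > 0"
  shows "ennreal (1 - s) * (\<integral>\<^sup>+(z::'a::euclidean_space). ennreal (truncated_kernel p s z) \<partial>lborel)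
     \<le> ennreal (sphere_area TYPE('a) / (s * p))"
proof -
  let ?c = "sphere_area TYPE('a)"
  have "ennreal (1 - s) * (\<integral>\<^sup>+(z::'a). ennreal (truncated_kernel p s z) \<partial>lborel)
     \<le> ennreal (1 - s) * ennreal (?c / (p * (1 - s)) + ?c / (s * p))"
    using assms by (intro mult_left_mono nn_integral_truncated_kernel_le) auto
  also have "\<dots> = ennreal ((1 - s) * (?c / (p * (1 - s)) + ?c / (s * p)))"
    using assms by (simp add: ennreal_mult')
  also have "(1 - s) * (?c / (p * (1 - s)) + ?c / (s * p)) = ?c / (s * p)"
    using assms by (simp add: field_simps)
  finally show ?thesis .
qed

subsection \<open>The growth rate\<close>

definition growth_rate :: "real \<Rightarrow> real \<Rightarrow> real \<Rightarrow> real" where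
  "growth_rate n \<sigma> R =
     (if \<sigma> < 1 then R powr (n - \<sigma>) / (1 - \<sigma>)
      else if \<sigma> = 1 then R powr (n - 1) * ln R
      else R powr (n - 1) / (\<sigma> - 1))"

lemma growth_rate_nonneg: "R \<ge> 1 \<Longrightarrow> growth_rate n \<sigma> R \<ge> 0"
  by (auto simp: growth_rate_def)

lemma growth_rate_conv_1:
  assumes "R > 0" "n \<ge> 1"
  shows "growth_rate (real n) \<sigma> R = R ^ (n - 1) * growth_rate 1 \<sigma> R"
proof -
  have "R powr (real n - 1 + e) = R ^ (n - 1) * R powr e" for e
    using assms by (simp add: powr_add flip: powr_realpow)
  from this[of 0] this[of "1 - \<sigma>"] show ?thesis
    using assms by (simp add: growth_rate_def)
qed

lemma one_le_growth_rate:
  assumes "R \<ge> 2" "\<sigma> > 0"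
  shows "1 \<le> (1 + \<sigma>) * growth_rate 1 \<sigma> R"
proof -
  consider "\<sigma> < 1" | "\<sigma> = 1" | "\<sigma> > 1" by linarith
  then show ?thesis
  proof cases
    assume "\<sigma> < 1"
    moreover have "1 \<le> R powr (1 - \<sigma>)"
      using assms \<open>\<sigma> < 1\<close> by (intro ge_one_powr_ge_zero) auto
    ultimately have "1 * 1 \<le> (1 + \<sigma>) * (R powr (1 - \<sigma>) / (1 - \<sigma>))"
      using assms by (intro mult_mono) (auto simp: le_divide_eq)
    with \<open>\<sigma> < 1\<close> show ?thesis by (simp add: growth_rate_def)
  next
    assume "\<sigma> = 1"
    moreover have "1 / 2 \<le> ln R"
      using ln2_ge_two_thirds ln_le_cancel_iff[of 2 R] assms by linarith
    ultimately show ?thesis using assms by (simp add: growth_rate_def)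
  next
    assume "\<sigma> > 1"
    then show ?thesis using assms by (simp add: growth_rate_def le_divide_eq)
  qed
qed

lemma nn_integral_boundary_layer:
  fixes R \<sigma> :: real
  assumes "R \<ge> 0"
  shows "(\<integral>\<^sup>+r. ennreal ((R + 1 - r) powr (-\<sigma>)) * indicator {0..R} r \<partial>lborel)
     = ennreal (if \<sigma> = 1 then ln (R + 1) else ((R + 1) powr (1 - \<sigma>) - 1) / (1 - \<sigma>))"
proof -
  define F where "F r = (if \<sigma> = 1 then - ln (R + 1 - r) else - ((R + 1 - r) powr (1 - \<sigma>) / (1 - \<sigma>)))" for r
  have "(F has_real_derivative (R + 1 - r) powr (-\<sigma>)) (at r)" if "r \<le> R" for r
    unfolding F_def using that
    by (cases "\<sigma> = 1") (auto intro!: derivative_eq_intros simp: powr_minus divide_simps)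
  then have "(\<integral>\<^sup>+r. ennreal ((R + 1 - r) powr (-\<sigma>)) * indicator {0..R} r \<partial>lborel) = ennreal (F R - F 0)"
    using assms by (intro nn_integral_FTC_Icc) auto
  then show ?thesis
    by (simp add: F_def diff_divide_distrib)
qed

lemma boundary_layer_le_growth_rate:
  fixes R \<sigma> :: real
  assumes "R \<ge> 2" "\<sigma> > 0"
  shows "(if \<sigma> = 1 then ln (R + 1) else ((R + 1) powr (1 - \<sigma>) - 1) / (1 - \<sigma>)) \<le> 2 * growth_rate 1 \<sigma> R"
proof -
  consider "\<sigma> < 1" | "\<sigma> = 1" | "\<sigma> > 1" by linarith
  then show ?thesis
  proof cases
    assume "\<sigma> < 1"
    have "(R + 1) powr (1 - \<sigma>) \<le> (2 * R) powr (1 - \<sigma>)"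
      using assms \<open>\<sigma> < 1\<close> by (intro powr_mono2) auto
    also have "\<dots> = 2 powr (1 - \<sigma>) * R powr (1 - \<sigma>)"
      using assms by (simp add: powr_mult)
    also have "\<dots> \<le> 2 powr 1 * R powr (1 - \<sigma>)"
      using assms by (intro mult_right_mono powr_mono) auto
    finally have "((R + 1) powr (1 - \<sigma>) - 1) / (1 - \<sigma>) \<le> 2 * R powr (1 - \<sigma>) / (1 - \<sigma>)"
      using \<open>\<sigma> < 1\<close> by (intro divide_right_mono) auto
    with \<open>\<sigma> < 1\<close> show ?thesis by (simp add: growth_rate_def)
  next
    assume "\<sigma> = 1"
    have "R + 1 \<le> R ^ 2"
      using assms mult_right_mono[of 2 R R] unfolding power2_eq_square by linarith
    then have "ln (R + 1) \<le> ln (R ^ 2)"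
      using assms by (subst ln_le_cancel_iff) auto
    with \<open>\<sigma> = 1\<close> assms show ?thesis by (simp add: growth_rate_def ln_realpow)
  next
    assume "\<sigma> > 1"
    have "((R + 1) powr (1 - \<sigma>) - 1) / (1 - \<sigma>) = (1 - (R + 1) powr (1 - \<sigma>)) / (\<sigma> - 1)"
      by (metis minus_diff_eq minus_divide_divide)
    also have "\<dots> \<le> 2 / (\<sigma> - 1)"
      using \<open>\<sigma> > 1\<close> by (intro divide_right_mono) (auto intro: order_trans[of _ 0])
    finally show ?thesis using \<open>\<sigma> > 1\<close> assms by (simp add: growth_rate_def)
  qed
qed

lemma nn_integral_ball_boundary_layer_le:
  fixes R \<sigma> :: real
  assumes "R \<ge> 2" "\<sigma> > 0"
  shows "(\<integral>\<^sup>+(x::'a::euclidean_space). indicator (ball 0 R) x * ennreal ((R + 1 - norm x) powr (-\<sigma>)) \<partial>lborel)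
     \<le> ennreal (2 * sphere_area TYPE('a) * growth_rate DIM('a) \<sigma> R)"
proof -
  let ?c = "sphere_area TYPE('a)"
  have "(\<integral>\<^sup>+(x::'a). indicator (ball 0 R) x * ennreal ((R + 1 - norm x) powr (-\<sigma>)) \<partial>lborel)
      \<le> ennreal (?c * R ^ (DIM('a) - 1)) *
        (\<integral>\<^sup>+r. ennreal ((R + 1 - r) powr (-\<sigma>)) * indicator {0..R} r \<partial>lborel)"
    using assms by (intro nn_integral_ball_norm_le) auto
  also have "\<dots> \<le> ennreal (?c * R ^ (DIM('a) - 1)) * ennreal (2 * growth_rate 1 \<sigma> R)"
    using assms by (subst nn_integral_boundary_layer)
      (simp, intro mult_left_mono ennreal_leI boundary_layer_le_growth_rate, auto)
  also have "\<dots> = ennreal (2 * ?c * growth_rate DIM('a) \<sigma> R)"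
    using assms by (subst ennreal_mult[symmetric])
      (auto simp: growth_rate_nonneg growth_rate_conv_1 Suc_le_eq mult_ac)
  finally show ?thesis .
qed

definition shell_const :: "'a::euclidean_space itself \<Rightarrow> real \<Rightarrow> real" where
  "shell_const _ p = sphere_area TYPE('a) * 2 ^ DIM('a) * (1 + p)"

lemma shell_const_nonneg: "p \<ge> 0 \<Longrightarrow> shell_const TYPE('a::euclidean_space) p \<ge> 0"
  by (simp add: shell_const_def)

lemma emeasure_shell_le_growth_rate:
  assumes "R \<ge> 2" "0 < \<sigma>" "\<sigma> \<le> p"
  shows "emeasure lborel (ball (0::'a::euclidean_space) (R + 2) - ball 0 R)
    \<le> ennreal (shell_const TYPE('a) p * growth_rate DIM('a) \<sigma> R)"
proof -
  let ?c = "sphere_area TYPE('a)" and ?n = "DIM('a)"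
  have "emeasure lborel (ball (0::'a) (R + 2) - ball 0 R) \<le> ennreal (?c * (R + 2) ^ (?n - 1) * 2)"
    using assms emeasure_shell_le[of R "R + 2", where 'a='a] by simp
  also have "\<dots> \<le> ennreal (shell_const TYPE('a) p * growth_rate ?n \<sigma> R)"
  proof (rule ennreal_leI)
    have "(R + 2) ^ (?n - 1) * 2 \<le> (2 * R) ^ (?n - 1) * 2"
      using assms by (intro mult_right_mono power_mono) auto
    also have "\<dots> = 2 ^ ?n * (R ^ (?n - 1) * 1)"
      by (cases ?n) (auto simp: power_mult_distrib)
    also have "1 \<le> (1 + p) * growth_rate 1 \<sigma> R"
      using assms one_le_growth_rate[of R \<sigma>] growth_rate_nonneg[of R 1 \<sigma>]
      by (meson add_left_mono mult_right_mono order_trans one_le_numeral)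
    finally have "(R + 2) ^ (?n - 1) * 2 \<le> 2 ^ ?n * (R ^ (?n - 1) * ((1 + p) * growth_rate 1 \<sigma> R))"
      using assms by (simp add: mult_left_mono)
    from mult_left_mono[OF this, of ?c]
    show "?c * (R + 2) ^ (?n - 1) * 2 \<le> shell_const TYPE('a) p * growth_rate ?n \<sigma> R"
      using assms by (simp add: shell_const_def growth_rate_conv_1 Suc_le_eq mult_ac)
  qed
  finally show ?thesis .
qed

subsection \<open>Submodularity of convex powers\<close>

lemma convex_on_majorization_le:
  fixes f :: "real \<Rightarrow> real"
  assumes f: "convex_on {a..b} f" and c: "c \<in> {a..b}" and sum: "c + d = a + b"
  shows "f c + f d \<le> f a + f b"
proof (cases "a = b")
  case False
  with c have "a < b" by auto
  define t where "t = (c - a) / (b - a)"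
  have t: "0 \<le> t" "t \<le> 1"
    using c \<open>a < b\<close> by (auto simp: t_def divide_simps)
  have "t * (b - a) = c - a"
    using \<open>a < b\<close> by (simp add: t_def)
  then have "c = (1 - t) *\<^sub>R a + t *\<^sub>R b" "d = (1 - (1 - t)) *\<^sub>R a + (1 - t) *\<^sub>R b"
    using sum by (auto simp: algebra_simps)
  then have "f c \<le> (1 - t) * f a + t * f b" "f d \<le> (1 - (1 - t)) * f a + (1 - t) * f b"
    using t \<open>a < b\<close> convex_onD_Icc[OF f, of t] convex_onD_Icc[OF f, of "1 - t"] by simp_all
  then show ?thesis
    by (simp add: algebra_simps)
qed (use c sum in auto)

lemma convex_on_abs_powr:
  assumes "p \<ge> 1"
  shows "convex_on UNIV (\<lambda>x::real. \<bar>x\<bar> powr p)"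
proof (rule convex_onI)
  have scale_le: "(t * r) powr p \<le> t * r powr p" if "0 < t" "t < 1" "0 \<le> r" for t r :: real
  proof -
    have "t powr p \<le> t powr 1"
      using that assms by (intro powr_mono') auto
    then show ?thesis
      using that by (simp add: powr_mult mult_right_mono)
  qed
  fix t x y :: real
  assume t: "0 < t" "t < 1"
  have "\<bar>(1 - t) *\<^sub>R x + t *\<^sub>R y\<bar> \<le> (1 - t) * \<bar>x\<bar> + t * \<bar>y\<bar>"
    using t by (intro order_trans[OF abs_triangle_ineq]) (simp add: abs_mult)
  then have "\<bar>(1 - t) *\<^sub>R x + t *\<^sub>R y\<bar> powr p \<le> ((1 - t) * \<bar>x\<bar> + t * \<bar>y\<bar>) powr p"
    using assms by (intro powr_mono2) auto
  also have "\<dots> \<le> (1 - t) * \<bar>x\<bar> powr p + t * \<bar>y\<bar> powr p"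
  proof (cases "x = 0 \<or> y = 0")
    case True
    then show ?thesis using t scale_le[of t "\<bar>y\<bar>"] scale_le[of "1 - t" "\<bar>x\<bar>"] by auto
  next
    case False
    then show ?thesis
      using t convex_onD[OF powr_convex[OF assms], of t "\<bar>x\<bar>" "\<bar>y\<bar>"] by simp
  qed
  finally show "\<bar>(1 - t) *\<^sub>R x + t *\<^sub>R y\<bar> powr p \<le> (1 - t) * \<bar>x\<bar> powr p + t * \<bar>y\<bar> powr p" .
qed simp

lemma abs_diff_powr_min_max_le:
  fixes a b f g p :: real
  assumes "p \<ge> 1"
  shows "\<bar>min a f - min b g\<bar> powr p + \<bar>max a f - max b g\<bar> powr p \<le> \<bar>a - b\<bar> powr p + \<bar>f - g\<bar> powr p"
proof -
  have convex: "convex_on I (\<lambda>x. \<bar>x\<bar> powr p)" if "convex I" for I :: "real set"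
    by (rule convex_on_subset[OF convex_on_abs_powr[OF assms] subset_UNIV that])
  consider "a \<le> f" "b \<le> g" | "f \<le> a" "g \<le> b" | "a \<le> f" "g \<le> b" | "f \<le> a" "b \<le> g"
    by linarith
  then show ?thesis
  proof cases
    assume "a \<le> f" "g \<le> b"
    then show ?thesis
      using convex_on_majorization_le[OF convex, of "a - b" "f - g" "a - g" "f - b"] by simp
  next
    assume "f \<le> a" "b \<le> g"
    then show ?thesis
      using convex_on_majorization_le[OF convex, of "f - g" "a - b" "f - b" "a - g"] by simp
  qed simp_all
qed

subsection \<open>The Gagliardo energy\<close>

lemma sigma_finite_completion:
  assumes "sigma_finite_measure M"
  shows "sigma_finite_measure (completion M)"
proof
  obtain A where A: "countable A" "A \<subseteq> sets M" "\<Union>A = space M" "\<forall>a\<in>A. emeasure M a \<noteq> \<infinity>"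
    using sigma_finite_measure.sigma_finite_countable[OF assms] by blast
  then have "emeasure (completion M) a \<noteq> \<infinity>" if "a \<in> A" for a
    using that by (simp add: subset_iff)
  with A show "\<exists>A. countable A \<and> A \<subseteq> sets (completion M) \<and> \<Union>A = space (completion M) \<and>
      (\<forall>a\<in>A. emeasure (completion M) a \<noteq> \<infinity>)"
    by (intro exI[of _ A]) auto
qed

definition gagliardo_kernel :: "real \<Rightarrow> real \<Rightarrow> ('a::euclidean_space \<Rightarrow> real) \<Rightarrow> 'a \<Rightarrow> 'a \<Rightarrow> real" where
  "gagliardo_kernel p s u x y = \<bar>u x - u y\<bar> powr p / norm (x - y) powr (real DIM('a) + s * p)"

definition gagliardo :: "real \<Rightarrow> real \<Rightarrow> ('a::euclidean_space \<Rightarrow> real) \<Rightarrow> 'a set \<Rightarrow> 'a set \<Rightarrow> ennreal" where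
  "gagliardo p s u A B =
     (\<integral>\<^sup>+x. \<integral>\<^sup>+y. ennreal (indicator A x * indicator B y * gagliardo_kernel p s u x y) \<partial>lebesgue \<partial>lebesgue)"

lemma Kps_conv_gagliardo: "Kps p s u A = (1/2) * gagliardo p s u A A + gagliardo p s u A (- A)"
  by (simp add: Kps_def gagliardo_def gagliardo_kernel_def)

lemma gagliardo_kernel_nonneg [simp]: "gagliardo_kernel p s u x y \<ge> 0"
  by (simp add: gagliardo_kernel_def)

lemma gagliardo_mono:
  assumes "A \<subseteq> A'" "B \<subseteq> B'"
  shows "gagliardo p s u A B \<le> gagliardo p s u A' B'"
  unfolding gagliardo_def using assms
  by (intro nn_integral_mono ennreal_leI mult_right_mono) (auto split: split_indicator)

lemma gagliardo_cong_AE: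
  assumes "AE x in lebesgue. x \<in> A \<union> B \<longrightarrow> u x = w x"
  shows "gagliardo p s u A B = gagliardo p s w A B"
  unfolding gagliardo_def
proof (rule nn_integral_cong_AE, use assms in eventually_elim)
  case (elim x)
  show ?case
    by (rule nn_integral_cong_AE, use assms in eventually_elim)
       (use elim in \<open>auto simp: gagliardo_kernel_def split: split_indicator\<close>)
qed

lemma gagliardo_le_nn_integral:
  assumes "AE x in lebesgue. x \<in> A \<longrightarrow>
    (\<integral>\<^sup>+y. ennreal (indicator B y * gagliardo_kernel p s u x y) \<partial>lebesgue) \<le> f x"
  shows "gagliardo p s u A B \<le> (\<integral>\<^sup>+x. indicator A x * f x \<partial>lebesgue)"
  unfolding gagliardo_def
  by (rule nn_integral_mono_AE, use assms in eventually_elim) (auto split: split_indicator)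

lemma borel_measurable_gagliardo_kernel:
  fixes u :: "'a::euclidean_space \<Rightarrow> real"
  assumes [measurable]: "u \<in> borel_measurable lebesgue" "A \<in> sets lebesgue" "B \<in> sets lebesgue"
  shows "(\<lambda>(x, y). ennreal (indicator A x * indicator B y * gagliardo_kernel p s u x y))
     \<in> borel_measurable (lebesgue \<Otimes>\<^sub>M lebesgue)"
proof -
  have id: "(\<lambda>x::'a. x) \<in> lebesgue \<rightarrow>\<^sub>M borel"
    by (simp add: measurable_completion)
  have [measurable]: "fst \<in> lebesgue \<Otimes>\<^sub>M lebesgue \<rightarrow>\<^sub>M (borel :: 'a measure)"
     "snd \<in> lebesgue \<Otimes>\<^sub>M lebesgue \<rightarrow>\<^sub>M (borel :: 'a measure)"
    using measurable_compose[OF measurable_fst id] measurable_compose[OF measurable_snd id] by auto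
  show ?thesis
    unfolding case_prod_beta gagliardo_kernel_def by measurable
qed

lemma gagliardo_conv_pair_measure:
  fixes u :: "'a::euclidean_space \<Rightarrow> real"
  assumes "u \<in> borel_measurable lebesgue" "A \<in> sets lebesgue" "B \<in> sets lebesgue"
  shows "gagliardo p s u A B =
    (\<integral>\<^sup>+(x, y). ennreal (indicator A x * indicator B y * gagliardo_kernel p s u x y) \<partial>(lebesgue \<Otimes>\<^sub>M lebesgue))"
  using sigma_finite_measure.nn_integral_fst[OF sigma_finite_completion[OF sigma_finite_lborel]
      borel_measurable_gagliardo_kernel[OF assms]]
  by (simp add: gagliardo_def)

lemma gagliardo_min_max_le:
  fixes u w :: "'a::euclidean_space \<Rightarrow> real"
  assumes "p \<ge> 1" and [measurable]: "u \<in> borel_measurable lebesgue" "w \<in> borel_measurable lebesgue"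
    and sets: "A \<in> sets lebesgue" "B \<in> sets lebesgue"
  shows "gagliardo p s (\<lambda>x. min (u x) (w x)) A B + gagliardo p s (\<lambda>x. max (u x) (w x)) A B
    \<le> gagliardo p s u A B + gagliardo p s w A B"
proof -
  have kernel_le: "gagliardo_kernel p s (\<lambda>x. min (u x) (w x)) x y + gagliardo_kernel p s (\<lambda>x. max (u x) (w x)) x y
      \<le> gagliardo_kernel p s u x y + gagliardo_kernel p s w x y" for x y
    unfolding gagliardo_kernel_def add_divide_distrib[symmetric]
    using assms by (intro divide_right_mono abs_diff_powr_min_max_le) auto
  show ?thesis
    using sets
    by (simp add: gagliardo_conv_pair_measure nn_integral_add[symmetric] borel_measurable_gagliardo_kernel)
       (use kernel_le in \<open>auto intro!: nn_integral_mono split: split_indicator simp flip: ennreal_plus\<close>)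
qed

lemma gagliardo_cover_le:
  fixes u :: "'a::euclidean_space \<Rightarrow> real"
  assumes [measurable]: "u \<in> borel_measurable lebesgue"
    and sets: "A \<in> sets lebesgue" "B \<in> sets lebesgue" "A1 \<in> sets lebesgue" "B1 \<in> sets lebesgue"
      "A2 \<in> sets lebesgue" "B2 \<in> sets lebesgue"
    and cover: "\<And>x y. x \<in> A \<Longrightarrow> y \<in> B \<Longrightarrow> x \<in> A1 \<and> y \<in> B1 \<or> x \<in> A2 \<and> y \<in> B2 \<or> u x = u y"
  shows "gagliardo p s u A B \<le> gagliardo p s u A1 B1 + gagliardo p s u A2 B2"
proof -
  have "indicator A x * indicator B y * gagliardo_kernel p s u x y
      \<le> indicator A1 x * indicator B1 y * gagliardo_kernel p s u x y
        + indicator A2 x * indicator B2 y * gagliardo_kernel p s u x y" for x y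
    using cover[of x y] by (auto simp: indicator_def gagliardo_kernel_def)
  then show ?thesis
    using sets
    by (simp add: gagliardo_conv_pair_measure nn_integral_add[symmetric] borel_measurable_gagliardo_kernel)
       (auto intro!: nn_integral_mono simp flip: ennreal_plus)
qed

lemma Kps_min_max_le:
  fixes u w :: "'a::euclidean_space \<Rightarrow> real"
  assumes "p \<ge> 1" "u \<in> borel_measurable lebesgue" "w \<in> borel_measurable lebesgue" "A \<in> sets lebesgue"
  shows "Kps p s (\<lambda>x. min (u x) (w x)) A + Kps p s (\<lambda>x. max (u x) (w x)) A \<le> Kps p s u A + Kps p s w A"
proof -
  let ?min = "\<lambda>x. min (u x) (w x)" and ?max = "\<lambda>x. max (u x) (w x)"
  have gagliardo_le: "gagliardo p s ?min A B + gagliardo p s ?max A B \<le> gagliardo p s u A B + gagliardo p s w A B"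
    if "B \<in> sets lebesgue" for B
    using assms that by (intro gagliardo_min_max_le)
  have "(1/2) * (gagliardo p s ?min A A + gagliardo p s ?max A A)
        + (gagliardo p s ?min A (- A) + gagliardo p s ?max A (- A))
      \<le> (1/2) * (gagliardo p s u A A + gagliardo p s w A A)
        + (gagliardo p s u A (- A) + gagliardo p s w A (- A))"
    by (rule add_mono[OF mult_left_mono[OF gagliardo_le] gagliardo_le])
       (use assms in \<open>auto simp: Compl_in_sets_lebesgue\<close>)
  then show ?thesis
    by (simp add: Kps_conv_gagliardo distrib_left add_ac)
qed

lemma half_le_ennreal: "(1/2) * x \<le> (x::ennreal)"
  using mult_right_mono[of "1/2" 1 x] by (simp add: divide_le_posI_ennreal)

lemma Kps_le_gagliardo_UNIV: "Kps p s u A \<le> 2 * gagliardo p s u A UNIV"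
proof -
  have "Kps p s u A \<le> gagliardo p s u A UNIV + gagliardo p s u A UNIV"
    unfolding Kps_conv_gagliardo
    by (intro add_mono order_trans[OF half_le_ennreal] gagliardo_mono) auto
  then show ?thesis by (simp add: mult_2)
qed

lemma Kps_subset_le:
  fixes u :: "'a::euclidean_space \<Rightarrow> real"
  assumes "u \<in> borel_measurable lebesgue" "B \<in> sets lebesgue" "C \<in> sets lebesgue" "B \<subseteq> C"
  shows "Kps p s u B \<le> 3 * ((1/2) * gagliardo p s u C C) + gagliardo p s u B (- C)"
proof -
  \<comment> \<open>The factor $3 = 1 + 2$ arises from covering $B \times (C \setminus B)$ by all of $C \times C$.\<close>
  let ?H = "(1/2) * gagliardo p s u C C"
  have "gagliardo p s u B (- B) \<le> gagliardo p s u B (- C) + gagliardo p s u C C"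
    using assms by (intro gagliardo_cover_le) (auto simp: Compl_in_sets_lebesgue)
  also have "gagliardo p s u C C = 2 * ?H"
    by (simp add: ennreal_times_divide flip: mult.assoc)
  finally have "Kps p s u B \<le> ?H + (gagliardo p s u B (- C) + 2 * ?H)"
    unfolding Kps_conv_gagliardo using assms(4) by (intro add_mono mult_left_mono gagliardo_mono) auto
  also have "\<dots> = 3 * ?H + gagliardo p s u B (- C)"
    using distrib_right[of 1 2 ?H] by (simp add: add_ac)
  finally show ?thesis .
qed

lemma nn_integral_gagliardo_kernel_exterior_le:
  fixes u :: "'a::euclidean_space \<Rightarrow> real" and p s r :: real
  assumes u: "AE x in lebesgue. \<bar>u x\<bar> \<le> 1" and "p \<ge> 1" "s > 0" and "\<bar>u x\<bar> \<le> 1" "norm x < r"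
  shows "(\<integral>\<^sup>+y. ennreal (indicator (- ball 0 r) y * gagliardo_kernel p s u x y) \<partial>lebesgue)
    \<le> ennreal (2 powr p * sphere_area TYPE('a) / (s * p)) * ennreal ((r - norm x) powr (- (s * p)))"
proof -
  have [measurable]: "- ball (0::'a) r \<in> sets borel"
    by auto
  let ?k = "\<lambda>y. ennreal (indicator (- ball 0 r) y / norm (x - y) powr (DIM('a) + s * p))"
  have "(\<integral>\<^sup>+y. ennreal (indicator (- ball 0 r) y * gagliardo_kernel p s u x y) \<partial>lebesgue)
    \<le> (\<integral>\<^sup>+y. ennreal (2 powr p) * ?k y \<partial>lebesgue)"
  proof (rule nn_integral_mono_AE, use u in eventually_elim)
    case (elim y)
    then have "\<bar>u x - u y\<bar> powr p \<le> 2 powr p"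
      using \<open>\<bar>u x\<bar> \<le> 1\<close> \<open>p \<ge> 1\<close> by (intro powr_mono2) auto
    then show ?case
      by (auto simp: gagliardo_kernel_def intro!: ennreal_leI divide_right_mono
          split: split_indicator simp flip: ennreal_mult)
  qed
  also have "\<dots> = ennreal (2 powr p) * (\<integral>\<^sup>+y. ?k y \<partial>lborel)"
    unfolding nn_integral_completion by (rule nn_integral_cmult) measurable
  also have "\<dots> \<le> ennreal (2 powr p) * ennreal (sphere_area TYPE('a) * (r - norm x) powr (- (s * p)) / (s * p))"
    using assms by (intro mult_left_mono nn_integral_kernel_outside_ball_le) auto
  also have "\<dots> = ennreal (2 powr p * sphere_area TYPE('a) / (s * p)) * ennreal ((r - norm x) powr (- (s * p)))"
    using assms by (simp flip: ennreal_mult)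
  finally show ?thesis .
qed

definition exterior_const :: "'a::euclidean_space itself \<Rightarrow> real \<Rightarrow> real" where
  "exterior_const _ p = 2 * 2 powr p * (sphere_area TYPE('a))\<^sup>2"

lemma exterior_const_pos: "exterior_const TYPE('a::euclidean_space) p > 0"
  unfolding exterior_const_def by (intro mult_pos_pos zero_less_power) auto

lemma gagliardo_ball_exterior_le:
  fixes u :: "'a::euclidean_space \<Rightarrow> real" and p s R :: real
  assumes u: "AE x in lebesgue. \<bar>u x\<bar> \<le> 1" and "p \<ge> 1" "s > 0" "R \<ge> 2"
  shows "gagliardo p s u (ball 0 R) (- ball 0 (R + 1))
    \<le> ennreal (exterior_const TYPE('a) p / s * growth_rate DIM('a) (s * p) R)"
proof -
  let ?c = "sphere_area TYPE('a)" and ?G = "growth_rate DIM('a) (s * p) R"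
  let ?E = "exterior_const TYPE('a) p / s * ?G"
  let ?D = "\<lambda>x::'a. ennreal ((R + 1 - norm x) powr (- (s * p)))"
  have [measurable]: "ball (0::'a) R \<in> sets borel"
    by auto
  have "gagliardo p s u (ball 0 R) (- ball 0 (R + 1))
      \<le> (\<integral>\<^sup>+x. indicator (ball 0 R) x * (ennreal (2 powr p * ?c / (s * p)) * ?D x) \<partial>lebesgue)"
    by (rule gagliardo_le_nn_integral, use u in eventually_elim, intro impI)
       (use assms in \<open>auto intro!: nn_integral_gagliardo_kernel_exterior_le\<close>)
  also have "\<dots> = ennreal (2 powr p * ?c / (s * p)) * (\<integral>\<^sup>+x. indicator (ball 0 R) x * ?D x \<partial>lborel)"
    unfolding nn_integral_completion mult.left_commute[of "indicator _ _"]
    by (rule nn_integral_cmult) measurable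
  also have "\<dots> \<le> ennreal (2 powr p * ?c / (s * p)) * ennreal (2 * ?c * ?G)"
    using assms by (intro mult_left_mono nn_integral_ball_boundary_layer_le) auto
  also have "\<dots> = ennreal (?E / p)"
    using assms by (subst ennreal_mult[symmetric])
      (auto simp: growth_rate_nonneg exterior_const_def power2_eq_square)
  also have "\<dots> \<le> ennreal ?E"
    using assms divide_left_mono[of 1 p ?E] exterior_const_pos[of p, where 'a='a]
    by (intro ennreal_leI) (auto simp: growth_rate_nonneg)
  finally show ?thesis .
qed

lemma nn_integral_gagliardo_kernel_Lipschitz_le:
  fixes w :: "'a::euclidean_space \<Rightarrow> real"
  assumes "p > 0" "L \<ge> 0" and lipschitz: "\<And>y. \<bar>w x - w y\<bar> \<le> L * min 1 (norm (x - y))"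
  shows "(\<integral>\<^sup>+y. ennreal (gagliardo_kernel p s w x y) \<partial>lebesgue)
    \<le> ennreal (L powr p) * (\<integral>\<^sup>+(z::'a). ennreal (truncated_kernel p s z) \<partial>lborel)"
proof -
  have "gagliardo_kernel p s w x y \<le> L powr p * truncated_kernel p s (x - y)" for y
  proof -
    have "\<bar>w x - w y\<bar> powr p \<le> (L * min 1 (norm (x - y))) powr p"
      using assms by (intro powr_mono2 lipschitz) auto
    also have "\<dots> = L powr p * min 1 (norm (x - y)) powr p"
      using assms by (simp add: powr_mult)
    finally show ?thesis
      by (auto simp: truncated_kernel_def gagliardo_kernel_def intro!: divide_right_mono)
  qed
  then have "(\<integral>\<^sup>+y. ennreal (gagliardo_kernel p s w x y) \<partial>lebesgue)
      \<le> (\<integral>\<^sup>+y. ennreal (L powr p) * ennreal (truncated_kernel p s (x - y)) \<partial>lborel)"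
    unfolding nn_integral_completion
    by (intro nn_integral_mono) (auto intro!: ennreal_leI simp flip: ennreal_mult')
  also have "\<dots> = ennreal (L powr p) * (\<integral>\<^sup>+y. ennreal (truncated_kernel p s (x - y)) \<partial>lborel)"
    by (rule nn_integral_cmult) measurable
  also have "(\<integral>\<^sup>+y. ennreal (truncated_kernel p s (x - y)) \<partial>lborel)
      = (\<integral>\<^sup>+(z::'a). ennreal (truncated_kernel p s z) \<partial>lborel)"
    by (rule nn_integral_lborel_diff) measurable
  finally show ?thesis .
qed

lemma weighted_gagliardo_Lipschitz_le:
  fixes w :: "'a::euclidean_space \<Rightarrow> real"
  assumes "0 < s" "s < 1" "p > 0" "L \<ge> 0" "A \<in> sets lebesgue"
    and lipschitz: "\<And>x y. \<bar>w x - w y\<bar> \<le> L * min 1 (norm (x - y))"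
  shows "ennreal (1 - s) * gagliardo p s w A UNIV
    \<le> ennreal (L powr p * sphere_area TYPE('a) / (s * p)) * emeasure lebesgue A"
proof -
  let ?T = "\<integral>\<^sup>+(z::'a). ennreal (truncated_kernel p s z) \<partial>lborel"
  have "gagliardo p s w A UNIV \<le> (\<integral>\<^sup>+x. indicator A x * (ennreal (L powr p) * ?T) \<partial>lebesgue)"
    using assms nn_integral_gagliardo_kernel_Lipschitz_le[OF _ _ lipschitz]
    by (intro gagliardo_le_nn_integral) simp
  also have "\<dots> = ennreal (L powr p) * ?T * emeasure lebesgue A"
    using assms by (subst mult.commute) (rule nn_integral_cmult_indicator)
  finally have "ennreal (1 - s) * gagliardo p s w A UNIV
      \<le> ennreal (1 - s) * (ennreal (L powr p) * ?T * emeasure lebesgue A)"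
    by (rule mult_left_mono) simp
  also have "\<dots> = ennreal (L powr p) * (ennreal (1 - s) * ?T) * emeasure lebesgue A"
    by (simp only: mult_ac)
  also have "\<dots> \<le> ennreal (L powr p) * ennreal (sphere_area TYPE('a) / (s * p)) * emeasure lebesgue A"
    using assms by (intro mult_left_mono mult_right_mono weighted_nn_integral_truncated_kernel_le) auto
  finally show ?thesis
    using assms by (simp flip: ennreal_mult)
qed

subsection \<open>The potential energy\<close>

definition potential :: "(real \<Rightarrow> real) \<Rightarrow> ('a::euclidean_space \<Rightarrow> real) \<Rightarrow> 'a set \<Rightarrow> ennreal" where
  "potential W u A = (\<integral>\<^sup>+x. ennreal (indicator A x * W (u x)) \<partial>lebesgue)"

lemma Eps_conv_potential: "Eps W p s u A = ennreal (1 - s) * Kps p s u A + potential W u A"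
  by (simp add: Eps_def potential_def)

lemma potential_mono:
  assumes "A \<subseteq> B"
  shows "potential W u A \<le> potential W u B"
  unfolding potential_def using assms
  by (intro nn_integral_mono) (auto split: split_indicator)

lemma potential_cong_AE:
  assumes "AE x in lebesgue. x \<in> A \<longrightarrow> W (u x) = V (w x)"
  shows "potential W u A = potential V w A"
  unfolding potential_def
  by (rule nn_integral_cong_AE, use assms in eventually_elim) (auto split: split_indicator)

lemma potential_le_emeasure:
  assumes "AE x in lebesgue. x \<in> A \<longrightarrow> W (u x) \<le> (if x \<in> B then M else 0)"
    and "B \<in> sets lebesgue"
  shows "potential W u A \<le> ennreal M * emeasure lebesgue B"
proof -
  have "potential W u A \<le> (\<integral>\<^sup>+x. ennreal M * indicator B x \<partial>lebesgue)"
    unfolding potential_def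
    by (rule nn_integral_mono_AE, use assms(1) in eventually_elim)
       (auto intro: ennreal_leI ennreal_neg split: split_indicator if_splits)
  also have "\<dots> = ennreal M * emeasure lebesgue B"
    using assms(2) by (rule nn_integral_cmult_indicator)
  finally show ?thesis .
qed

lemma borel_measurable_lsc_on_interval:
  assumes lsc: "lsc_on_interval W"
  shows "(\<lambda>x. indicator {-1..1} x * W x) \<in> borel_measurable borel"
proof -
  have "{x \<in> {-1..1}. t < W x} \<in> sets (restrict_space borel {-1..1})" for t
  proof -
    let ?S = "{x \<in> {-1..1}. t < W x}" and ?U = "\<Union>{T. open T \<and> T \<inter> {-1..1} \<subseteq> {x. t < W x}}"
    have "?S \<subseteq> {-1..1} \<inter> ?U"
    proof
      fix x assume x: "x \<in> ?S"
      with lsc obtain e where "e > 0" "\<And>y. y \<in> {-1..1} \<Longrightarrow> \<bar>y - x\<bar> < e \<Longrightarrow> t < W y"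
        unfolding lsc_on_interval_def by blast
      then have "x \<in> ball x e" "ball x e \<inter> {-1..1} \<subseteq> {x. t < W x}"
        by (auto simp: dist_real_def abs_minus_commute)
      with x show "x \<in> {-1..1} \<inter> ?U" by blast
    qed
    then have "?S = {-1..1} \<inter> ?U" by blast
    moreover have "?U \<in> sets borel"
      by (intro borel_open open_Union) auto
    ultimately show ?thesis
      unfolding sets_restrict_space by blast
  qed
  then have "W \<in> borel_measurable (restrict_space borel {-1..1})"
    by (simp add: borel_measurable_iff_greater space_restrict_space)
  then show ?thesis
    by (simp add: borel_measurable_restrict_space_iff)
qed

lemma potential_min_max:
  fixes u w :: "'a::euclidean_space \<Rightarrow> real"
  assumes lsc: "lsc_on_interval W"
    and [measurable]: "u \<in> borel_measurable lebesgue" "w \<in> borel_measurable lebesgue" "A \<in> sets lebesgue"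
    and bounds: "AE x in lebesgue. \<bar>u x\<bar> \<le> 1" "AE x in lebesgue. \<bar>w x\<bar> \<le> 1"
  shows "potential W (\<lambda>x. min (u x) (w x)) A + potential W (\<lambda>x. max (u x) (w x)) A
    = potential W u A + potential W w A"
proof -
  define V where "V x = indicator {-1..1} x * W x" for x
  have [measurable]: "V \<in> borel_measurable borel"
    unfolding V_def by (rule borel_measurable_lsc_on_interval[OF lsc])
  have potential_V: "potential W f A = potential V f A" if "AE x in lebesgue. \<bar>f x\<bar> \<le> 1" for f :: "'a \<Rightarrow> real"
    by (rule potential_cong_AE, use that in eventually_elim) (auto simp: V_def indicator_def abs_le_iff)
  have "potential V (\<lambda>x. min (u x) (w x)) A + potential V (\<lambda>x. max (u x) (w x)) A
      = potential V u A + potential V w A"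
    unfolding potential_def
    by (subst (1 2) nn_integral_add[symmetric])
       (auto intro!: nn_integral_cong simp: min_def max_def add.commute)
  moreover have "AE x in lebesgue. \<bar>min (u x) (w x)\<bar> \<le> 1" "AE x in lebesgue. \<bar>max (u x) (w x)\<bar> \<le> 1"
    using bounds by (eventually_elim, auto simp: min_def max_def)+
  ultimately show ?thesis
    using bounds by (simp add: potential_V)
qed

subsection \<open>Comparison of minimizers\<close>

lemma Eps_min_max_le:
  fixes u w :: "'a::euclidean_space \<Rightarrow> real"
  assumes "p \<ge> 1" "lsc_on_interval W" "A \<in> sets lebesgue"
    and "u \<in> borel_measurable lebesgue" "w \<in> borel_measurable lebesgue"
    and "AE x in lebesgue. \<bar>u x\<bar> \<le> 1" "AE x in lebesgue. \<bar>w x\<bar> \<le> 1"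
  shows "Eps W p s (\<lambda>x. min (u x) (w x)) A + Eps W p s (\<lambda>x. max (u x) (w x)) A
    \<le> Eps W p s u A + Eps W p s w A"
proof -
  have "ennreal (1 - s) * (Kps p s (\<lambda>x. min (u x) (w x)) A + Kps p s (\<lambda>x. max (u x) (w x)) A)
      \<le> ennreal (1 - s) * (Kps p s u A + Kps p s w A)"
    using assms by (intro mult_left_mono Kps_min_max_le) auto
  from add_mono[OF this potential_min_max[THEN eq_refl]] show ?thesis
    using assms by (simp add: Eps_conv_potential distrib_left add_ac)
qed

lemma min_in_Xsp:
  assumes "p \<ge> 1" "A \<in> sets lebesgue" "u \<in> Xsp s p A" "w \<in> Xsp s p A"
  shows "(\<lambda>x. min (u x) (w x)) \<in> Xsp s p A"
proof -
  have meas: "u \<in> borel_measurable lebesgue" "w \<in> borel_measurable lebesgue"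
    and bounds: "AE x in lebesgue. \<bar>u x\<bar> \<le> 1" "AE x in lebesgue. \<bar>w x\<bar> \<le> 1"
    and finite: "Kps p s u A < \<infinity>" "Kps p s w A < \<infinity>"
    using assms by (auto simp: Xsp_def)
  have "Kps p s (\<lambda>x. min (u x) (w x)) A \<le> Kps p s u A + Kps p s w A"
    using Kps_min_max_le[OF assms(1) meas assms(2)] by (rule order_trans[rotated]) simp
  also have "\<dots> < \<infinity>"
    using finite by simp
  finally have "Kps p s (\<lambda>x. min (u x) (w x)) A < \<infinity>" .
  moreover have "AE x in lebesgue. \<bar>min (u x) (w x)\<bar> \<le> 1"
    using bounds by eventually_elim auto
  ultimately show ?thesis
    using meas by (simp add: Xsp_def)
qed

lemma minimizer_max_le:
  fixes u w :: "'a::euclidean_space \<Rightarrow> real"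
  assumes "p \<ge> 1" "lsc_on_interval W" "A \<in> sets lebesgue"
    and u: "minimizer W p s u A" and "w \<in> Xsp s p A"
    and outside: "AE x in lebesgue. x \<notin> A \<longrightarrow> u x \<le> w x"
    and finite: "Eps W p s u A < \<infinity>"
  shows "Eps W p s (\<lambda>x. max (u x) (w x)) A \<le> Eps W p s w A"
proof -
  let ?min = "\<lambda>x. min (u x) (w x)" and ?max = "\<lambda>x. max (u x) (w x)"
  have "?min \<in> Xsp s p A"
    using assms by (intro min_in_Xsp) (auto simp: minimizer_def)
  moreover have "AE x in lebesgue. x \<notin> A \<longrightarrow> ?min x = u x"
    using outside by eventually_elim auto
  ultimately have "Eps W p s u A \<le> Eps W p s ?min A"
    using u by (auto simp: minimizer_def)
  then have "Eps W p s u A + Eps W p s ?max A \<le> Eps W p s ?min A + Eps W p s ?max A"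
    by (rule add_right_mono)
  also have "\<dots> \<le> Eps W p s u A + Eps W p s w A"
    using assms by (intro Eps_min_max_le) (auto simp: minimizer_def Xsp_def)
  finally show ?thesis
    using finite by (auto simp: ennreal_add_left_cancel_le)
qed

lemma Eps_less_top:
  assumes "u \<in> Xsp s p A" "A \<in> sets lebesgue" "emeasure lebesgue A < \<infinity>"
    and W_le: "\<And>x. x \<in> {-1..1} \<Longrightarrow> W x \<le> M"
  shows "Eps W p s u A < \<infinity>"
proof -
  have "AE x in lebesgue. \<bar>u x\<bar> \<le> 1"
    using assms by (simp add: Xsp_def)
  then have "AE x in lebesgue. x \<in> A \<longrightarrow> W (u x) \<le> (if x \<in> A then M else 0)"
    by eventually_elim (auto intro!: W_le)
  then have "potential W u A \<le> ennreal M * emeasure lebesgue A"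
    using assms(2) by (rule potential_le_emeasure)
  also have "\<dots> < \<infinity>"
    using assms by (simp add: ennreal_mult_less_top)
  finally show ?thesis
    using assms(1) by (simp add: Eps_conv_potential Xsp_def ennreal_mult_less_top)
qed

lemma Eps_subset_le:
  fixes u w :: "'a::euclidean_space \<Rightarrow> real"
  assumes "u \<in> borel_measurable lebesgue" "B \<in> sets lebesgue" "C \<in> sets lebesgue" "B \<subseteq> C" "C \<subseteq> A"
    and eq: "AE x in lebesgue. x \<in> C \<longrightarrow> u x = w x"
  shows "Eps W p s u B \<le> 3 * Eps W p s w A + ennreal (1 - s) * gagliardo p s u B (- C)"
proof -
  have "Kps p s u B \<le> 3 * ((1/2) * gagliardo p s u C C) + gagliardo p s u B (- C)"
    using assms by (intro Kps_subset_le)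
  also have "gagliardo p s u C C = gagliardo p s w C C"
    using eq by (intro gagliardo_cong_AE) auto
  also have "(1/2) * gagliardo p s w C C \<le> Kps p s w A"
    unfolding Kps_conv_gagliardo using assms(5)
    by (intro add_increasing2 mult_left_mono gagliardo_mono) auto
  finally have K: "Kps p s u B \<le> 3 * Kps p s w A + gagliardo p s u B (- C)"
    by (simp add: mult_left_mono)
  have "potential W u B \<le> potential W u C"
    using assms by (intro potential_mono)
  also have "\<dots> = potential W w C"
    using eq by (intro potential_cong_AE) auto
  also have "\<dots> \<le> potential W w A"
    using assms by (intro potential_mono)
  also have "\<dots> \<le> 3 * potential W w A"
    using mult_right_mono[of 1 3 "potential W w A"] by simp
  finally have "Eps W p s u B
      \<le> ennreal (1 - s) * (3 * Kps p s w A + gagliardo p s u B (- C)) + 3 * potential W w A"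
    unfolding Eps_conv_potential by (intro add_mono mult_left_mono K) auto
  also have "\<dots> = 3 * Eps W p s w A + ennreal (1 - s) * gagliardo p s u B (- C)"
    unfolding Eps_conv_potential by (simp add: distrib_left mult_ac add_ac)
  finally show ?thesis .
qed

subsection \<open>The barrier\<close>

definition cutoff :: "real \<Rightarrow> 'a::euclidean_space \<Rightarrow> real" where
  "cutoff R x = -1 + 2 * min 1 (max 0 (norm x - (R + 1)))"

lemma abs_cutoff_le_1: "\<bar>cutoff R x\<bar> \<le> 1"
  by (auto simp: cutoff_def min_def max_def)

lemma cutoff_inside: "x \<in> ball 0 (R + 1) \<Longrightarrow> cutoff R x = -1"
  by (simp add: cutoff_def)

lemma cutoff_outside: "x \<notin> ball 0 (R + 2) \<Longrightarrow> cutoff R x = 1"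
  by (simp add: cutoff_def)

lemma cutoff_Lipschitz: "\<bar>cutoff R x - cutoff R y\<bar> \<le> 2 * min 1 (norm (x - y))"
proof -
  have "norm x \<le> norm y + norm (x - y)" "norm y \<le> norm x + norm (x - y)"
    using norm_triangle_ineq3[of x y] by linarith+
  then show ?thesis
    unfolding cutoff_def min_def max_def by (auto split: if_splits)
qed

lemma borel_measurable_cutoff: "cutoff R \<in> borel_measurable lebesgue"
  by (intro measurable_completion) (simp add: cutoff_def[abs_def])

definition cutoff_const :: "'a::euclidean_space itself \<Rightarrow> real \<Rightarrow> real \<Rightarrow> real" where
  "cutoff_const _ p M = 2 * (exterior_const TYPE('a) p + 2 powr p * sphere_area TYPE('a) * shell_const TYPE('a) p)
     + M * shell_const TYPE('a) p"

lemma cutoff_const_nonneg: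
  assumes "p \<ge> 0" "M \<ge> 0"
  shows "cutoff_const TYPE('a::euclidean_space) p M \<ge> 0"
  using assms exterior_const_pos[of p, where 'a='a] shell_const_nonneg[of p, where 'a='a]
  by (simp add: cutoff_const_def)

lemma weighted_gagliardo_cutoff_le:
  assumes "p \<ge> 1" "0 < s" "s < 1" "R \<ge> 2"
  shows "ennreal (1 - s) * gagliardo p s (cutoff R) (ball (0::'a::euclidean_space) (R + 2)) UNIV
    \<le> ennreal ((exterior_const TYPE('a) p + 2 powr p * sphere_area TYPE('a) * shell_const TYPE('a) p)
        / s * growth_rate DIM('a) (s * p) R)"
proof -
  let ?S = "ball (0::'a) (R + 2) - ball 0 R" and ?g = "gagliardo p s (cutoff R :: 'a \<Rightarrow> real)"
  let ?c = "sphere_area TYPE('a)" and ?G = "growth_rate DIM('a) (s * p) R"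
  let ?X = "exterior_const TYPE('a) p / s * ?G" and ?Y = "2 powr p * ?c * shell_const TYPE('a) p / s * ?G"
  have nonneg: "?X \<ge> 0" "?Y \<ge> 0"
    using assms exterior_const_pos[of p, where 'a='a] by (simp_all add: growth_rate_nonneg shell_const_nonneg)
  have "?g (ball 0 (R + 2)) UNIV \<le> ?g (ball 0 R) (- ball 0 (R + 1)) + ?g ?S UNIV"
    by (rule gagliardo_cover_le[OF borel_measurable_cutoff]) (auto simp: cutoff_inside)
  then have "ennreal (1 - s) * ?g (ball 0 (R + 2)) UNIV
      \<le> ennreal (1 - s) * ?g (ball 0 R) (- ball 0 (R + 1)) + ennreal (1 - s) * ?g ?S UNIV"
    by (simp add: mult_left_mono flip: distrib_left)
  also have "ennreal (1 - s) * ?g (ball 0 R) (- ball 0 (R + 1)) \<le> 1 * ennreal ?X"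
    using assms by (intro mult_mono gagliardo_ball_exterior_le) (auto simp: abs_cutoff_le_1)
  also have "ennreal (1 - s) * ?g ?S UNIV \<le> ennreal (2 powr p * ?c / (s * p)) * emeasure lebesgue ?S"
    using assms by (intro weighted_gagliardo_Lipschitz_le cutoff_Lipschitz) auto
  also have "\<dots> \<le> ennreal (2 powr p * ?c / s) * ennreal (shell_const TYPE('a) p * ?G)"
    using assms emeasure_shell_le_growth_rate[of R "s * p" p, where 'a='a]
    by (intro mult_mono ennreal_leI divide_left_mono) auto
  also have "\<dots> = ennreal ?Y"
    using assms by (subst ennreal_mult'[symmetric]) (auto simp: mult_ac)
  finally show ?thesis
    using nonneg by (simp add: add_mono add_divide_distrib distrib_right)
qed

lemma weighted_Kps_cutoff_le:
  assumes "p \<ge> 1" "0 < s" "s < 1" "R \<ge> 2"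
  shows "ennreal (1 - s) * Kps p s (cutoff R) (ball (0::'a::euclidean_space) (R + 2))
    \<le> ennreal (2 * (exterior_const TYPE('a) p + 2 powr p * sphere_area TYPE('a) * shell_const TYPE('a) p)
        / s * growth_rate DIM('a) (s * p) R)"
    (is "_ \<le> ennreal (2 * ?K / s * ?G)")
proof -
  let ?\<Omega> = "ball (0::'a) (R + 2)" and ?g = "gagliardo p s (cutoff R :: 'a \<Rightarrow> real)"
  have "ennreal (1 - s) * Kps p s (cutoff R) ?\<Omega> \<le> ennreal (1 - s) * (2 * ?g ?\<Omega> UNIV)"
    by (intro mult_left_mono Kps_le_gagliardo_UNIV) simp
  also have "\<dots> = 2 * (ennreal (1 - s) * ?g ?\<Omega> UNIV)"
    by (rule mult.left_commute)
  also have "\<dots> \<le> 2 * ennreal (?K / s * ?G)"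
    using assms by (intro mult_left_mono weighted_gagliardo_cutoff_le) auto
  also have "\<dots> = ennreal (2 * (?K / s * ?G))"
    by (subst ennreal_mult') auto
  finally show ?thesis
    by (simp only: times_divide_eq_right mult.assoc times_divide_eq_left)
qed

lemma potential_cutoff_le:
  assumes "p \<ge> 1" "0 < s" "s < 1" "R \<ge> 2" "M \<ge> 0"
    and W: "W (-1) \<le> 0" "\<And>x. x \<in> {-1..1} \<Longrightarrow> W x \<le> M"
  shows "potential W (cutoff R) (ball (0::'a::euclidean_space) (R + 2))
    \<le> ennreal (M * shell_const TYPE('a) p / s * growth_rate DIM('a) (s * p) R)"
proof -
  let ?S = "ball (0::'a) (R + 2) - ball 0 R" and ?G = "growth_rate DIM('a) (s * p) R"
  have "W (cutoff R x) \<le> (if x \<in> ?S then M else 0)" if "x \<in> ball 0 (R + 2)" for x :: 'a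
    using that W(1) W(2)[of "cutoff R x"] abs_cutoff_le_1[of R x] by (auto simp: cutoff_inside abs_le_iff)
  then have "potential W (cutoff R) (ball (0::'a) (R + 2)) \<le> ennreal M * emeasure lebesgue ?S"
    by (intro potential_le_emeasure AE_I2) auto
  also have "\<dots> \<le> ennreal M * ennreal (shell_const TYPE('a) p * ?G)"
    using assms emeasure_shell_le_growth_rate[of R "s * p" p, where 'a='a] by (intro mult_left_mono) auto
  also have "\<dots> = ennreal (M * shell_const TYPE('a) p * ?G * 1)"
    using assms by (simp add: mult.assoc flip: ennreal_mult')
  also have "\<dots> \<le> ennreal (M * shell_const TYPE('a) p * ?G * (1 / s))"
    using assms by (intro ennreal_leI mult_left_mono) (auto simp: growth_rate_nonneg shell_const_nonneg)
  finally show ?thesis by simp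
qed

lemma Eps_cutoff_le:
  assumes "p \<ge> 1" "0 < s" "s < 1" "R \<ge> 2" "M \<ge> 0"
    and "W (-1) \<le> 0" "\<And>x. x \<in> {-1..1} \<Longrightarrow> W x \<le> M"
  shows "Eps W p s (cutoff R) (ball (0::'a::euclidean_space) (R + 2))
    \<le> ennreal (cutoff_const TYPE('a) p M / s * growth_rate DIM('a) (s * p) R)"
proof -
  have "Eps W p s (cutoff R) (ball (0::'a) (R + 2))
    \<le> ennreal (2 * (exterior_const TYPE('a) p + 2 powr p * sphere_area TYPE('a) * shell_const TYPE('a) p)
        / s * growth_rate DIM('a) (s * p) R)
      + ennreal (M * shell_const TYPE('a) p / s * growth_rate DIM('a) (s * p) R)"
    unfolding Eps_conv_potential using assms by (intro add_mono weighted_Kps_cutoff_le potential_cutoff_le) auto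
  then show ?thesis
    using assms exterior_const_pos[of p, where 'a='a]
    by (simp add: cutoff_const_def add_divide_distrib distrib_right growth_rate_nonneg shell_const_nonneg
        flip: ennreal_plus)
qed

lemma cutoff_in_Xsp:
  assumes "p \<ge> 1" "0 < s" "s < 1" "R \<ge> 2"
  shows "cutoff R \<in> Xsp s p (ball (0::'a::euclidean_space) (R + 2))"
proof -
  have "ennreal (1 - s) * Kps p s (cutoff R) (ball (0::'a) (R + 2)) < \<infinity>"
    using weighted_Kps_cutoff_le[OF assms] by (rule le_less_trans) simp
  then have "Kps p s (cutoff R) (ball (0::'a) (R + 2)) < \<infinity>"
    using assms by (auto simp: ennreal_mult_less_top)
  then show ?thesis
    by (simp add: Xsp_def borel_measurable_cutoff abs_cutoff_le_1)
qed

lemma minimizer_Eps_ball_le: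
  fixes u :: "'a::euclidean_space \<Rightarrow> real"
  assumes params: "p \<ge> 1" "0 < s" "s < 1" "R \<ge> 2" "M \<ge> 0"
    and lsc: "lsc_on_interval W" and W: "W (-1) \<le> 0" "\<And>x. x \<in> {-1..1} \<Longrightarrow> W x \<le> M"
    and u: "minimizer W p s u (ball 0 (R + 2))"
  shows "Eps W p s u (ball 0 R)
    \<le> ennreal ((3 * cutoff_const TYPE('a) p M + exterior_const TYPE('a) p) / s
        * growth_rate DIM('a) (s * p) R)"
proof -
  let ?\<Omega> = "ball (0::'a) (R + 2)" and ?w = "\<lambda>x. max (u x) (cutoff R x)"
  let ?G = "growth_rate DIM('a) (s * p) R"
  let ?K = "cutoff_const TYPE('a) p M / s * ?G" and ?X = "exterior_const TYPE('a) p / s * ?G"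
  have u_Xsp: "u \<in> Xsp s p ?\<Omega>"
    using u by (simp add: minimizer_def)
  then have meas: "u \<in> borel_measurable lebesgue" and bound: "AE x in lebesgue. \<bar>u x\<bar> \<le> 1"
    by (auto simp: Xsp_def)
  have "AE x in lebesgue. x \<notin> ?\<Omega> \<longrightarrow> u x \<le> cutoff R x"
    using bound by eventually_elim (auto simp: cutoff_outside)
  moreover have "Eps W p s u ?\<Omega> < \<infinity>"
    using u_Xsp emeasure_lborel_ball_finite W(2) by (intro Eps_less_top) auto
  ultimately have "Eps W p s ?w ?\<Omega> \<le> Eps W p s (cutoff R) ?\<Omega>"
    using params lsc u by (intro minimizer_max_le cutoff_in_Xsp) auto
  also have "\<dots> \<le> ennreal ?K"
    using params W by (rule Eps_cutoff_le)
  finally have barrier: "Eps W p s ?w ?\<Omega> \<le> ennreal ?K" .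
  have "AE x in lebesgue. x \<in> ball 0 (R + 1) \<longrightarrow> u x = ?w x"
    using bound by eventually_elim (auto simp: cutoff_inside)
  with meas have "Eps W p s u (ball 0 R)
      \<le> 3 * Eps W p s ?w ?\<Omega> + ennreal (1 - s) * gagliardo p s u (ball 0 R) (- ball 0 (R + 1))"
    by (intro Eps_subset_le) auto
  also have "\<dots> \<le> 3 * ennreal ?K + 1 * ennreal ?X"
    using params bound by (intro add_mono mult_mono barrier gagliardo_ball_exterior_le) auto
  also have "\<dots> = ennreal 3 * ennreal ?K + ennreal ?X"
    by simp
  also have "\<dots> = ennreal (3 * ?K + ?X)"
    using params exterior_const_pos[of p, where 'a='a]
    by (subst ennreal_mult'[symmetric], simp, subst ennreal_plus[symmetric])
       (simp_all add: cutoff_const_nonneg growth_rate_nonneg)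
  also have "3 * ?K + ?X = (3 * cutoff_const TYPE('a) p M + exterior_const TYPE('a) p) / s * ?G"
    by (simp add: add_divide_distrib distrib_right)
  finally show ?thesis .
qed

lemma W1_at_minus_1: "W1 W lam Lam theta m \<Longrightarrow> W (-1) \<le> 0"
  unfolding W1_def by (auto dest!: bspec[of _ _ "-1"])

lemma W1_le:
  assumes "W1 W lam Lam theta m" "Lam \<ge> 0" "m \<ge> 0" "x \<in> {-1..1}"
  shows "W x \<le> Lam * 2 powr m"
proof -
  have "W x \<le> Lam * \<bar>1 + x\<bar> powr m"
    using assms unfolding W1_def by auto
  also have "\<dots> \<le> Lam * 2 powr m"
    using assms by (intro mult_left_mono powr_mono2) auto
  finally show ?thesis .
qed

theorem mainTheorem6:
  fixes p m Lam :: real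
  assumes "p > 1" and "m \<ge> p" and "Lam \<ge> 1"
  shows "\<exists>C>0. \<forall>(W::real \<Rightarrow> real) lam theta q c1 s R (u :: 'a::euclidean_space \<Rightarrow> real).
     (\<forall>x\<in>{-1..1}. W x \<ge> 0) \<and> lsc_on_interval W \<and>
     0 < lam \<and> lam \<le> 1 \<and> -1 < theta \<and> theta < 1 \<and> W1 W lam Lam theta m \<and>
     0 < q \<and> q < 1 \<and> 0 < c1 \<and> W2 W q c1 m \<and>
     0 < s \<and> s < 1 \<and> R \<ge> 2 \<and> minimizer W p s u (ball 0 (R + 2))
     \<longrightarrow> Eps W p s u (ball 0 R) \<le> ennreal (C / s *
           (if s < 1 / p then R powr (real DIM('a) - s * p) / (1 - s * p)
            else if s = 1 / p then R powr (real DIM('a) - 1) * ln R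
            else R powr (real DIM('a) - 1) / (s * p - 1)))"
proof -
  define C where "C = 3 * cutoff_const TYPE('a) p (Lam * 2 powr m) + exterior_const TYPE('a) p"
  have "C > 0"
    using assms by (simp add: C_def add_nonneg_pos cutoff_const_nonneg exterior_const_pos)
  have Eps_le: "Eps W p s u (ball 0 R) \<le> ennreal (C / s * growth_rate DIM('a) (s * p) R)"
    if "lsc_on_interval W" "W1 W lam Lam theta m" "0 < s" "s < 1" "R \<ge> 2"
      "minimizer W p s u (ball 0 (R + 2))"
    for W lam theta s R and u :: "'a \<Rightarrow> real"
    unfolding C_def using assms that
    by (intro minimizer_Eps_ball_le W1_at_minus_1[OF that(2)] W1_le[OF that(2)]) auto
  have rate: "growth_rate DIM('a) (s * p) R =
      (if s < 1 / p then R powr (real DIM('a) - s * p) / (1 - s * p)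
       else if s = 1 / p then R powr (real DIM('a) - 1) * ln R
       else R powr (real DIM('a) - 1) / (s * p - 1))" for s R
    unfolding growth_rate_def using assms by (auto simp: field_simps)
  show ?thesis
    unfolding rate[symmetric]
    by (intro exI[of _ C] conjI allI impI \<open>C > 0\<close>) (elim conjE, rule Eps_le)
qed

end
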